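(* Suppose, with all constants $\zeta,Q,M,L_X,G_X$ independent of the horizon $T$: (1) (Network) (a) there is a scalar $\zeta>0$ such that $[A_t]_{ij}>\zeta$ whenever $[A_t]_{ij}>0$, for all rounds $t$; (b) $\sum_{j=1}^n[A_t]_{ij}=\sum_{i=1}^n[A_t]_{ij}=1$ for all rounds $t$ and all $i,j\in\mathcal V$; (c) for some positive integer $Q$, the union graph $\bigcup_{i=kQ+1}^{(k+1)Q}\mathcal G_i$ is strongly connected for every integer $k\ge0$. (2) $\|\boldsymbol{x}_1-\boldsymbol{x}_2\|\le M$ for all $\boldsymbol{x}_1,\boldsymbol{x}_2\in\boldsymbol{X}$, where $M$ is finite. (3) $|f_{i,t}(\boldsymbol{x}_1)-f_{i,t}(\boldsymbol{x}_2)|\le L_X\|\boldsymbol{x}_1-\boldsymbol{x}_2\|$ for all $i,t$ and all $\boldsymbol{x}_1,\boldsymbol{x}_2\in\boldsymbol{X}$, with $L_X>0$. (4) $\|\nabla f_{i,t}(\boldsymbol{x}_1)-\nabla f_{i,t}(\boldsymbol{x}_2)\|\le G_X\|\boldsymbol{x}_1-\boldsymbol{x}_2\|$ for all $i,t$ and all $\boldsymbol{x}_1,\boldsymbol{x}_2\in\boldsymbol{X}$. Suppose further that $H_T=o(T)$ and $D_T=o(T)$ as $T\to\infty$. For each $T\ge2$ run the algorithm DOFW-CO (described in the context) over $T$ rounds with step size $\alpha=\gamma\sqrt{\frac{H_T+1}{T}}$, where $\gamma>0$ is a constant (independent of $T$) guaranteeing $\alpha\le1$. Then for every agent $j\in\mathcal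 V$, $$\mathbf{Regret}_d^j(T)\le\mathcal O\Big(\sqrt{T(1+H_T)}+D_T\Big),$$ i.e. there is a constant $C$ independent of $T$ such that $\mathbf{Regret}_d^j(T)\le C\big(\sqrt{T(1+H_T)}+D_T\big)$ for all $T\ge2$.
   Context: Setting. $\mathcal V=\{1,\dots,n\}$ is a set of agents. $\boldsymbol{X}\subset\mathbb R^d$ is a nonempty convex compact set and $\|\cdot\|$ is the Euclidean norm. For each agent $i$ and time $t\ge1$, the real-valued loss function $f_{i,t}$ is convex on $\boldsymbol{X}$ and differentiable at the points of $\boldsymbol{X}$, with gradient $\nabla f_{i,t}$. Put $F_t(\boldsymbol{x})=\sum_{i=1}^n f_{i,t}(\boldsymbol{x})$ and let $\boldsymbol{x}_t^*\in\arg\min_{\boldsymbol{x}\in\boldsymbol{X}}F_t(\boldsymbol{x})$. The losses, the networks and the initial points $\boldsymbol{x}_{i,1}$ do not depend on the horizon $T$. Network. For each $t\ge 1$, $\mathcal G_t=\{\mathcal V,\mathcal E_t,A_t\}$ is a directed graph with edge set $\mathcal E_t\subseteq\mathcal V\times\mathcal V$ and weight matrix $A_t\in\mathbb R^{n\times n}$. Let $\mathcal N_i^{in}(t)=\{j:(j,i)\in\mathcal E_t\}\cup\{i\}$. Then $[A_t]_{ij}>0$ if $j\in\mathcal N_i^{in}(t)$ and $[A_t]_{ij}=0$ otherwise. A union of graphs has vertex set $\mathcal V$ and the union of the edge sets. Algorithm DOFW-CO with step size $\alpha\in(0,1]$ and initial points $\boldsymbol{x}_{i,1}\in\boldsymbol{X}$.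 For $t=1,\dots,T$ and every $i\in\mathcal V$: $\hat{\boldsymbol{x}}_{i,t}=\sum_{j\in\mathcal N_i^{in}(t)}[A_t]_{ij}\boldsymbol{x}_{j,t}$; $\overline\nabla f_{i,1}=\nabla f_{i,1}(\hat{\boldsymbol{x}}_{i,1})$ if $t=1$, and $\overline\nabla f_{i,t}=\widehat\nabla f_{i,t-1}+\nabla f_{i,t}(\hat{\boldsymbol{x}}_{i,t})-\nabla f_{i,t-1}(\hat{\boldsymbol{x}}_{i,t-1})$ if $t\ge2$; $\widehat\nabla f_{i,t}=\sum_{j\in\mathcal N_i^{in}(t)}[A_t]_{ij}\overline\nabla f_{j,t}$; $\boldsymbol{v}_{i,t}\in\arg\min_{\boldsymbol{x}\in\boldsymbol{X}}\langle\boldsymbol{x},\widehat\nabla f_{i,t}\rangle$; $\boldsymbol{x}_{i,t+1}=\hat{\boldsymbol{x}}_{i,t}+\alpha(\boldsymbol{v}_{i,t}-\hat{\boldsymbol{x}}_{i,t})$. Notation. The dynamic regret of agent $j$ is $\mathbf{Regret}_d^j(T)=\sum_{t=1}^TF_t(\boldsymbol{x}_{j,t})-\sum_{t=1}^TF_t(\boldsymbol{x}_t^* )$. The function variation is $H_T=\sum_{t=1}^T\max_{i\in\mathcal V}\max_{\boldsymbol{x}\in\boldsymbol{X}}|f_{i,t+1}(\boldsymbol{x})-f_{i,t}(\boldsymbol{x})|$ and the gradient variation is $D_T=\sum_{t=1}^T\max_{i\in\mathcal V}\max_{\boldsymbol{x}\in\boldsymbol{X}}\|\nabla f_{i,t+1}(\boldsymbol{x})-\nabla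 f_{i,t}(\boldsymbol{x})\|$. *)

theory Defs
  imports "HOL-Analysis.Analysis" "HOL-Library.Landau_Symbols" "Graph_Theory.Digraph_Component"
begin

text \<open>
  The agents are the elements of a finite index type \<open>'n\<close>; the decision space is
  \<open>real ^ 'd\<close>.  Losses are written \<open>f i t\<close> and gradients \<open>g i t\<close>, for agent \<open>i\<close> and
  round \<open>t\<close>.  Rounds are numbered from 1; values at round 0 are never used.
\<close>

definition global_loss :: "('n::finite \<Rightarrow> nat \<Rightarrow> real ^ 'd \<Rightarrow> real) \<Rightarrow> nat \<Rightarrow> real ^ 'd \<Rightarrow> real" where
  "global_loss f t x = (\<Sum>i\<in>UNIV. f i t x)"

definition in_neighbours :: "('n \<times> 'n) set \<Rightarrow> 'n \<Rightarrow> 'n set" where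
  "in_neighbours E i = {j. (j, i) \<in> E} \<union> {i}"

definition union_graph :: "(nat \<Rightarrow> ('n \<times> 'n) set) \<Rightarrow> nat set \<Rightarrow> 'n pair_pre_digraph" where
  "union_graph E I = \<lparr>pverts = UNIV, parcs = (\<Union>t\<in>I. E t)\<rparr>"

text \<open>
  A run fixes only the iterates \<open>x i t\<close> for \<open>1 \<le> t \<le> T + 1\<close>.  The minimisers \<open>v i t\<close> of the
  linear subproblems need not be unique, so a run is a relation and not a function of the data.
  In the entry \<open>A t $ i $ j\<close>, \<open>i\<close> is the row (the receiving agent).
\<close>

definition dofw_co_run ::
  "(real ^ 'd) set \<Rightarrow> (nat \<Rightarrow> ('n::finite \<times> 'n) set) \<Rightarrow> (nat \<Rightarrow> real ^ 'n ^ 'n) \<Rightarrow>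
   ('n \<Rightarrow> nat \<Rightarrow> real ^ 'd \<Rightarrow> real ^ 'd) \<Rightarrow> real \<Rightarrow> nat \<Rightarrow> ('n \<Rightarrow> real ^ 'd) \<Rightarrow>
   ('n \<Rightarrow> nat \<Rightarrow> real ^ 'd) \<Rightarrow> bool" where
  "dofw_co_run X E A g \<alpha> T x1 x \<longleftrightarrow>
     (\<forall>i. x i 1 = x1 i) \<and>
     (\<exists>xhat gbar ghat v. \<forall>t\<in>{1..T}. \<forall>i.
        xhat i t = (\<Sum>j\<in>in_neighbours (E t) i. (A t $ i $ j) *\<^sub>R x j t) \<and>
        gbar i t =
          (if t = 1 then g i 1 (xhat i 1)
           else ghat i (t - 1) + g i t (xhat i t) - g i (t - 1) (xhat i (t - 1))) \<and>
        ghat i t = (\<Sum>j\<in>in_neighbours (E t) i. (A t $ i $ j) *\<^sub>R gbar j t) \<and>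
        is_arg_min (\<lambda>y. y \<bullet> ghat i t) (\<lambda>y. y \<in> X) (v i t) \<and>
        x i (t + 1) = xhat i t + \<alpha> *\<^sub>R (v i t - xhat i t))"

definition dynamic_regret ::
  "('n::finite \<Rightarrow> nat \<Rightarrow> real ^ 'd \<Rightarrow> real) \<Rightarrow> (nat \<Rightarrow> real ^ 'd) \<Rightarrow>
   ('n \<Rightarrow> nat \<Rightarrow> real ^ 'd) \<Rightarrow> 'n \<Rightarrow> nat \<Rightarrow> real" where
  "dynamic_regret f xstar x j T =
     (\<Sum>t=1..T. global_loss f t (x j t)) - (\<Sum>t=1..T. global_loss f t (xstar t))"

text \<open>
  The suprema over \<open>X\<close> below are maxima whenever \<open>X\<close> is compact and nonempty and the losses
  (respectively gradients) are continuous on \<open>X\<close>.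
\<close>

definition fun_variation ::
  "(real ^ 'd) set \<Rightarrow> ('n::finite \<Rightarrow> nat \<Rightarrow> real ^ 'd \<Rightarrow> real) \<Rightarrow> nat \<Rightarrow> real" where
  "fun_variation X f T =
     (\<Sum>t=1..T. MAX i. SUP x\<in>X. \<bar>f i (t + 1) x - f i t x\<bar>)"

definition grad_variation ::
  "(real ^ 'd) set \<Rightarrow> ('n::finite \<Rightarrow> nat \<Rightarrow> real ^ 'd \<Rightarrow> real ^ 'd) \<Rightarrow> nat \<Rightarrow> real" where
  "grad_variation X g T =
     (\<Sum>t=1..T. MAX i. SUP x\<in>X. norm (g i (t + 1) x - g i t x))"

end

theory Submission
  imports Defs
begin

text \<open>
  Follow the average iterate \<open>xbar t\<close> of the agents and its optimality gap for the loss of round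
  \<open>t\<close>.  Since the weights are doubly stochastic, mixing does not change averages, so \<open>xbar\<close> makes a
  Frank-Wolfe step with the average of the directions \<open>v i t\<close>.  For a smooth convex loss this
  decreases the gap by the fraction \<open>\<alpha>\<close>, up to three errors: a quadratic term of order \<open>\<alpha>\<^sup>2\<close>,
  the change of the loss between two rounds, and \<open>\<alpha>\<close> times the error of the trackers \<open>ghat i t\<close> as
  estimates of the average gradient (\<open>gap_recursion\<close>).  Summing over the rounds and dividing by \<open>\<alpha>\<close>
  bounds the total gap by a multiple of \<open>(1 + H) / \<alpha> + \<alpha> * T\<close> plus the total tracking error, where
  \<open>H\<close> is the function variation (\<open>sum_gap_le\<close>).

  The tracking error is a disagreement between agents.  The average tracker equals the average
  gradient at the query points (\<open>mean_gbar\<close>), so the error comes from how far the iterates and the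
  trackers of different agents lie apart.  Both families follow the mixing dynamics up to
  perturbations: of size \<open>\<alpha> * M\<close> for the iterates; for the trackers, of the size of the change of
  the gradients plus \<open>G\<close> times the movement of the query points.  Connectivity makes mixing contract
  the disagreement by a fixed factor over a window of \<open>2 * Q * n\<close> rounds, with \<open>n\<close> agents
  (\<open>evolve_lower_bound\<close>, \<open>evolve_spread_contract\<close>).  Hence the total disagreement is at most a
  constant times the initial disagreement plus the total perturbation (\<open>sum_spread_le\<close>), which is of
  order \<open>1 + \<alpha> * T\<close> for the iterates and \<open>1 + \<alpha> * T + D\<close> for the trackers, where \<open>D\<close> is the
  gradient variation.

  By the Lipschitz bound on the losses, the regret of a single agent exceeds that of the average
  iterate by at most a multiple of the total disagreement of the iterates.  It is therefore of order
  \<open>(1 + H) / \<alpha> + \<alpha> * T + D\<close> (\<open>regret_le_spreads\<close>).  The step size \<open>\<gamma> * sqrt ((H + 1) / T)\<close> balances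
  the first two terms: each becomes a multiple of \<open>sqrt (T * (1 + H))\<close>, which is at least 1 and so
  absorbs the terms that do not depend on \<open>T\<close>.
\<close>

section \<open>Mixing and disagreement\<close>

definition mix :: "real ^ 'n ^ 'n \<Rightarrow> ('n \<Rightarrow> 'v::real_vector) \<Rightarrow> 'n::finite \<Rightarrow> 'v" where
  "mix W y i = (\<Sum>j\<in>UNIV. (W $ i $ j) *\<^sub>R y j)"

definition mean :: "('n::finite \<Rightarrow> 'v::real_vector) \<Rightarrow> 'v" where
  "mean y = (\<Sum>i\<in>UNIV. y i) /\<^sub>R real CARD('n)"

definition spread :: "('n::finite \<Rightarrow> 'v::real_normed_vector) \<Rightarrow> real" where
  "spread y = (MAX (i, j). norm (y i - y j))"

lemma norm_diff_le_spread: "norm (y i - y j) \<le> spread y"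
proof -
  have "norm (y i - y j) \<in> range (\<lambda>(i, j). norm (y i - y j))"
    by (rule range_eqI[of _ _ "(i, j)"]) simp
  then show ?thesis unfolding spread_def by (intro Max_ge) auto
qed

lemma spread_leI: "(\<And>i j. norm (y i - y j) \<le> c) \<Longrightarrow> spread y \<le> c"
  unfolding spread_def by (subst Max_le_iff) auto

lemma spread_nonneg: "0 \<le> spread y"
  using norm_diff_le_spread[of y undefined undefined] by simp

lemma spread_perturb:
  assumes "\<And>i. norm (y i - z i) \<le> \<epsilon>"
  shows "spread y \<le> spread z + 2 * \<epsilon>"
proof (rule spread_leI)
  fix i j
  have "y i - y j = (y i - z i) + (z i - z j) - (y j - z j)" by simp
  then have "norm (y i - y j) \<le> norm (y i - z i) + norm (z i - z j) + norm (y j - z j)"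
    by (metis norm_triangle_le_diff norm_triangle_ineq add_right_mono)
  with assms[of i] assms[of j] norm_diff_le_spread[of z i j]
  show "norm (y i - y j) \<le> spread z + 2 * \<epsilon>" by linarith
qed

lemma mean_const: "mean (\<lambda>i::'n::finite. c) = c"
  unfolding mean_def by (simp add: sum_constant_scaleR del: sum_constant)

lemma mean_diff: "mean (\<lambda>i. y i - z i) = mean y - mean z"
  unfolding mean_def by (simp add: sum_subtractf scaleR_diff_right)

lemma mean_diff_const: "mean y - c = mean (\<lambda>i. y i - c)"
  by (simp add: mean_diff mean_const)

lemma norm_mean_le:
  fixes y :: "'n::finite \<Rightarrow> 'v::real_normed_vector"
  assumes "\<And>i. norm (y i) \<le> c"
  shows "norm (mean y) \<le> c"
proof -
  have "norm (\<Sum>i\<in>UNIV. y i) \<le> real CARD('n) * c"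
    using sum_norm_bound[of "UNIV :: 'n set" y c] assms by simp
  then show ?thesis unfolding mean_def by (simp add: field_simps)
qed

lemma norm_mean_diff_le_spread: "norm (mean y - y i) \<le> spread y"
  unfolding mean_diff_const by (rule norm_mean_le) (rule norm_diff_le_spread)

lemma mean_add: "mean (\<lambda>i. y i + z i) = mean y + mean z"
  unfolding mean_def by (simp add: sum.distrib scaleR_add_right)

lemma mean_scaleR: "mean (\<lambda>i. c *\<^sub>R y i) = c *\<^sub>R mean y"
  unfolding mean_def by (simp add: scaleR_sum_right[symmetric] mult.commute)

lemma mean_in_convex:
  fixes y :: "'n::finite \<Rightarrow> 'v::real_vector"
  assumes "convex X" "\<And>i. y i \<in> X"
  shows "mean y \<in> X"
  unfolding mean_def scaleR_sum_right by (rule convex_sum) (use assms in auto)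

lemma mean_mono:
  fixes a b :: "'n::finite \<Rightarrow> real"
  assumes "\<And>i. a i \<le> b i"
  shows "mean a \<le> mean b"
  unfolding mean_def using assms by (simp add: sum_mono divide_right_mono)

lemma mean_inner: "mean y \<bullet> u = mean (\<lambda>i. y i \<bullet> u)"
  unfolding mean_def by (simp add: inner_sum_left)

section \<open>Consensus under connected mixing\<close>

text \<open>
  Connectivity enters the proof only in this form: a path from inside \<open>S\<close> to outside \<open>S\<close> has
  an edge that crosses the boundary, so information held in \<open>S\<close> spreads.
\<close>

lemma strongly_connected_leaving_edge:
  assumes "strongly_connected (with_proj (union_graph E I))" "S \<noteq> {}" "S \<noteq> UNIV"
  obtains t u w where "t \<in> I" "(u, w) \<in> E t" "u \<in> S" "w \<notin> S"
proof -
  let ?G = "with_proj (union_graph E I)"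
  obtain a b where ab: "a \<in> S" "b \<notin> S" using assms by auto
  have "a \<rightarrow>\<^sup>*\<^bsub>?G\<^esub> b"
    using assms(1) by (auto simp: strongly_connected_def union_graph_def)
  then have "\<exists>u w. u \<in> S \<and> w \<notin> S \<and> (u, w) \<in> arcs_ends ?G"
    unfolding reachable_def using ab(2)
  proof (induction rule: rtrancl_on_induct)
    case base
    then show ?case using ab by simp
  next
    case (step p q)
    then show ?case by blast
  qed
  then show ?thesis
    using that by (auto simp: union_graph_def arcs_ends_def arc_to_ends_def)
qed

locale consensus_network =
  fixes A :: "nat \<Rightarrow> real ^ 'n ^ 'n" and E :: "nat \<Rightarrow> ('n::finite \<times> 'n) set"
    and \<zeta> :: real and Q :: nat
  assumes weights_pos: "\<And>t i j. t \<ge> 1 \<Longrightarrow> j \<in> in_neighbours (E t) i \<Longrightarrow> A t $ i $ j > 0"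
    and weights_zero: "\<And>t i j. t \<ge> 1 \<Longrightarrow> j \<notin> in_neighbours (E t) i \<Longrightarrow> A t $ i $ j = 0"
    and zeta_pos: "\<zeta> > 0"
    and zeta_less: "\<And>t i j. t \<ge> 1 \<Longrightarrow> A t $ i $ j > 0 \<Longrightarrow> A t $ i $ j > \<zeta>"
    and row_sums: "\<And>t i. t \<ge> 1 \<Longrightarrow> (\<Sum>j\<in>UNIV. A t $ i $ j) = 1"
    and column_sums: "\<And>t j. t \<ge> 1 \<Longrightarrow> (\<Sum>i\<in>UNIV. A t $ i $ j) = 1"
    and Q_pos: "Q > 0"
    and connected:
      "\<And>k. strongly_connected (with_proj (union_graph E {k * Q + 1 .. (k + 1) * Q}))"
begin

lemma weight_nonneg: "t \<ge> 1 \<Longrightarrow> 0 \<le> A t $ i $ j"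
  using weights_pos[of t j i] weights_zero[of t j i] by (cases "j \<in> in_neighbours (E t) i") auto

lemma edge_weight: "t \<ge> 1 \<Longrightarrow> (u, w) \<in> E t \<Longrightarrow> \<zeta> \<le> A t $ w $ u"
  using weights_pos[of t u w] zeta_less[of t w u] by (force simp: in_neighbours_def)

lemma self_weight: "t \<ge> 1 \<Longrightarrow> \<zeta> \<le> A t $ i $ i"
  using weights_pos[of t i i] zeta_less[of t i i] by (force simp: in_neighbours_def)

lemma zeta_le_1: "\<zeta> \<le> 1"
proof -
  have "A 1 $ i $ i \<le> (\<Sum>j\<in>UNIV. A 1 $ i $ j)" for i
    by (rule member_le_sum) (auto simp: weight_nonneg)
  with self_weight[of 1 undefined] row_sums[of 1 undefined] show ?thesis by (smt (verit) le_refl)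
qed

lemma sum_in_neighbours_eq_mix:
  assumes "t \<ge> 1"
  shows "(\<Sum>j\<in>in_neighbours (E t) i. (A t $ i $ j) *\<^sub>R y j) = mix (A t) y i"
  unfolding mix_def using assms
  by (intro sum.mono_neutral_left) (auto simp: weights_zero)

text \<open>
  Row sums 1 make mixing commute with translations, so the distance of a mixed value from a fixed
  vector is again bounded by \<open>norm_mix_le\<close>.
\<close>

lemma mix_diff_const:
  assumes "t \<ge> 1"
  shows "mix (A t) y i - c = mix (A t) (\<lambda>j. y j - c) i"
  unfolding mix_def using row_sums[OF assms, of i]
  by (simp add: scaleR_diff_right sum_subtractf scaleR_sum_left[symmetric])

lemma norm_mix_le:
  assumes t: "t \<ge> 1" and c: "\<And>j. norm (y j) \<le> c"
  shows "norm (mix (A t) y i) \<le> c"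
proof -
  have "norm (mix (A t) y i) \<le> (\<Sum>j\<in>UNIV. A t $ i $ j * c)"
    unfolding mix_def using c weight_nonneg[OF t]
    by (intro sum_norm_le) (auto simp: abs_of_nonneg intro!: mult_left_mono)
  also have "\<dots> = c" using row_sums[OF t] by (simp add: sum_distrib_right[symmetric])
  finally show ?thesis .
qed

lemma norm_mix_diff_le_spread: "t \<ge> 1 \<Longrightarrow> norm (mix (A t) y i - y j) \<le> spread y"
  unfolding mix_diff_const by (rule norm_mix_le) (auto intro: norm_diff_le_spread)

lemma mix_in_convex:
  assumes "t \<ge> 1" "convex X" "\<And>j. y j \<in> X"
  shows "mix (A t) y i \<in> X"
  unfolding mix_def using assms weight_nonneg row_sums by (intro convex_sum) auto

text \<open>
  Column sums 1 are what makes mixing preserve the average over the agents.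
\<close>

lemma mean_mix:
  assumes "t \<ge> 1"
  shows "mean (mix (A t) y) = mean y"
proof -
  have "(\<Sum>i\<in>UNIV. mix (A t) y i) = (\<Sum>j\<in>UNIV. \<Sum>i\<in>UNIV. (A t $ i $ j) *\<^sub>R y j)"
    unfolding mix_def by (rule sum.swap)
  also have "\<dots> = (\<Sum>j\<in>UNIV. y j)"
    by (simp add: scaleR_sum_left[symmetric] column_sums[OF assms])
  finally show ?thesis by (simp add: mean_def)
qed

lemma norm_mean_diff_mix_le_spread:
  assumes "t \<ge> 1"
  shows "norm (mean y - mix (A t) y i) \<le> spread y"
proof -
  have "norm (mix (A t) y i - mean y) \<le> spread y"
    unfolding mix_diff_const[OF assms]
    by (rule norm_mix_le[OF assms]) (metis norm_mean_diff_le_spread norm_minus_commute)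
  then show ?thesis by (simp add: norm_minus_commute)
qed

primrec evolve :: "nat \<Rightarrow> ('n \<Rightarrow> 'v::real_vector) \<Rightarrow> nat \<Rightarrow> 'n \<Rightarrow> 'v" where
  "evolve s y 0 = y"
| "evolve s y (Suc k) = mix (A (s + k)) (evolve s y k)"

text \<open>
  Connectivity is assumed only for the blocks that start at a multiple of \<open>Q\<close>, plus 1.  A window
  of \<open>2 * Q\<close> rounds contains a full such block wherever it starts, so the contraction below holds
  from every starting round, which makes it possible to sum it over all rounds.
\<close>

lemma leaving_edge_in_window:
  assumes "s \<ge> 1" "S \<noteq> {}" "S \<noteq> UNIV"
  obtains r u w where "s \<le> r" "r < s + 2 * Q" "(u, w) \<in> E r" "u \<in> S" "w \<notin> S"
proof -
  define m where "m = (s - 1) div Q"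
  have "s - 1 = m * Q + (s - 1) mod Q" "(s - 1) mod Q < Q"
    using Q_pos by (simp_all add: m_def)
  then have m: "m * Q < s" "s \<le> m * Q + Q" using \<open>s \<ge> 1\<close> by linarith+
  obtain r u w where r: "r \<in> {(m + 1) * Q + 1 .. (m + 1 + 1) * Q}"
    and "(u, w) \<in> E r" "u \<in> S" "w \<notin> S"
    using strongly_connected_leaving_edge[OF connected[of "m + 1"] assms(2,3)] by metis
  moreover from r m have "s \<le> r" "r < s + 2 * Q" by (auto simp: algebra_simps)
  ultimately show ?thesis using that by blast
qed

lemma evolve_nonneg:
  fixes z :: "'n \<Rightarrow> real"
  assumes "s \<ge> 1" "\<And>i. 0 \<le> z i"
  shows "0 \<le> evolve s z k i"
proof (induction k arbitrary: i)
  case (Suc k)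
  then show ?case using assms(1) by (auto simp: mix_def intro!: sum_nonneg mult_nonneg_nonneg weight_nonneg)
qed (use assms in simp)

lemma evolve_Suc_ge:
  fixes z :: "'n \<Rightarrow> real"
  assumes "s \<ge> 1" "\<And>i. 0 \<le> z i" "\<zeta> \<le> A (s + k) $ i $ j" "\<zeta> ^ k * c \<le> evolve s z k j"
  shows "\<zeta> ^ Suc k * c \<le> evolve s z (Suc k) i"
proof -
  have "\<zeta> ^ Suc k * c \<le> \<zeta> * evolve s z k j"
    using assms(4) zeta_pos by (simp add: mult.assoc)
  also have "\<dots> \<le> A (s + k) $ i $ j * evolve s z k j"
    using assms evolve_nonneg[OF assms(1,2)] by (intro mult_right_mono) auto
  also have "\<dots> \<le> evolve s z (Suc k) i"
    unfolding evolve.simps mix_def real_scaleR_def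
    using assms(1) evolve_nonneg[OF assms(1,2)] weight_nonneg
    by (intro member_le_sum) auto
  finally show ?thesis .
qed

text \<open>
  The contraction mechanism.  Call an agent informed after \<open>k\<close> rounds if its value is at least
  \<open>\<zeta> ^ k\<close> times the initial value of agent \<open>j\<close>.  A self-loop has weight at least \<open>\<zeta>\<close>, so an informed
  agent remains informed; an edge has weight at least \<open>\<zeta>\<close>, so it informs its head.
  Every \<open>2 * Q\<close> rounds some edge leaves the informed set, hence after \<open>2 * Q * n\<close> rounds, where \<open>n\<close> is
  the number of agents, all agents are informed.
\<close>

lemma evolve_lower_bound:
  fixes z :: "'n \<Rightarrow> real"
  assumes s: "s \<ge> 1" and z: "\<And>i. 0 \<le> z i"
  shows "\<zeta> ^ (2 * Q * CARD('n)) * z j \<le> evolve s z (2 * Q * CARD('n)) i"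
proof -
  define S where "S k = {i. \<zeta> ^ k * z j \<le> evolve s z k i}" for k
  have mono1: "S k \<subseteq> S (Suc k)" for k
    unfolding S_def using evolve_Suc_ge[OF s z self_weight] s by auto
  then have mono: "S k \<subseteq> S l" if "k \<le> l" for k l
    using that lift_Suc_mono_le[of S] by blast
  have j: "j \<in> S 0" by (simp add: S_def)
  have grow: "S k = UNIV \<or> card (S k) < card (S (k + 2 * Q))" for k
  proof (cases "S k = UNIV")
    case False
    have "S k \<noteq> {}" using mono[of 0 k] j by auto
    then obtain r u w where r: "s + k \<le> r" "r < s + k + 2 * Q" "(u, w) \<in> E r" "u \<in> S k" "w \<notin> S k"
      using leaving_edge_in_window[of "s + k" "S k"] False s by auto
    define l where "l = r - s"
    have l: "r = s + l" "k \<le> l" "Suc l \<le> k + 2 * Q" using r by (auto simp: l_def)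
    have "u \<in> S l" using mono[OF l(2)] r by auto
    then have "w \<in> S (Suc l)"
      using evolve_Suc_ge[OF s z edge_weight[of "s + l" u w]] s r(3) l(1) by (auto simp: S_def)
    then have "w \<in> S (k + 2 * Q)" using mono[OF l(3)] by auto
    then have "S k \<subset> S (k + 2 * Q)" using r(5) mono[of k "k + 2 * Q"] by auto
    then show ?thesis by (simp add: psubset_card_mono)
  qed simp
  have "S (2 * Q * m) = UNIV \<or> m < card (S (2 * Q * m))" for m
  proof (induction m)
    case 0
    then show ?case using j by (auto simp: card_gt_0_iff)
  next
    case (Suc m)
    have eq: "2 * Q * Suc m = 2 * Q * m + 2 * Q" by simp
    from Suc grow[of "2 * Q * m"] mono[of "2 * Q * m" "2 * Q * m + 2 * Q"]
    show ?case unfolding eq by (metis Suc_lessI less_trans_Suc not_less_eq top.extremum_uniqueI le_add1)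
  qed
  then have "S (2 * Q * CARD('n)) = UNIV"
    by (metis card_mono finite_class.finite_UNIV linorder_not_le top_greatest)
  then show ?thesis by (auto simp: S_def)
qed

text \<open>
  Reduction of vector-valued mixing to the scalar case, along a fixed direction \<open>u\<close>.
\<close>

lemma evolve_shift:
  fixes y :: "'n \<Rightarrow> 'v::real_inner"
  assumes "s \<ge> 1"
  shows "evolve s (\<lambda>i. y i \<bullet> u - c) k i = evolve s y k i \<bullet> u - c"
proof (induction k arbitrary: i)
  case (Suc k)
  have "evolve s (\<lambda>i. y i \<bullet> u - c) (Suc k) i
      = mix (A (s + k)) (\<lambda>i. evolve s y k i \<bullet> u - c) i"
    unfolding evolve.simps using Suc.IH by presburger
  also have "\<dots> = mix (A (s + k)) (\<lambda>i. evolve s y k i \<bullet> u) i - c"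
    using mix_diff_const[of "s + k" "\<lambda>i. evolve s y k i \<bullet> u" i c] assms by simp
  finally show ?case by (simp add: mix_def inner_sum_left)
qed simp

text \<open>
  Test the difference of two agents against its own direction \<open>u\<close>.  In that direction the
  scalar lower bound pulls every agent above the smallest initial component by the fraction
  \<open>\<zeta> ^ (2 * Q * n)\<close> of the initial range, while no agent exceeds the largest initial component.
\<close>

lemma evolve_spread_contract:
  fixes y :: "'n \<Rightarrow> 'v::real_inner"
  assumes s: "s \<ge> 1"
  shows "spread (evolve s y (2 * Q * CARD('n))) \<le> (1 - \<zeta> ^ (2 * Q * CARD('n))) * spread y"
proof (rule spread_leI)
  fix i j
  define \<eta> where "\<eta> = \<zeta> ^ (2 * Q * CARD('n))"
  define w where "w = evolve s y (2 * Q * CARD('n)) i - evolve s y (2 * Q * CARD('n)) j"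
  define u where "u = sgn w"
  have range: "finite (range (\<lambda>l. y l \<bullet> u))" "range (\<lambda>l. y l \<bullet> u) \<noteq> {}" by auto
  obtain a where "Min (range (\<lambda>l. y l \<bullet> u)) = y a \<bullet> u" using Min_in[OF range] by blast
  then have a: "y a \<bullet> u \<le> y l \<bullet> u" for l using Min_le[OF range(1)] by (metis rangeI)
  obtain b where "Max (range (\<lambda>l. y l \<bullet> u)) = y b \<bullet> u" using Max_in[OF range] by blast
  then have b: "y l \<bullet> u \<le> y b \<bullet> u" for l using Max_ge[OF range(1)] by (metis rangeI)
  have lo: "\<eta> * (y b \<bullet> u - y a \<bullet> u) \<le> evolve s y (2 * Q * CARD('n)) j \<bullet> u - y a \<bullet> u"
    using evolve_lower_bound[OF s, of "\<lambda>i. y i \<bullet> u - y a \<bullet> u" b j] a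
    by (simp add: evolve_shift[OF s] \<eta>_def)
  have up: "evolve s y (2 * Q * CARD('n)) i \<bullet> u \<le> y b \<bullet> u"
    using evolve_nonneg[OF s, of "\<lambda>i. y i \<bullet> (-u) - y b \<bullet> (-u)" "2 * Q * CARD('n)" i] b
    unfolding evolve_shift[OF s] by simp
  have "norm w = w \<bullet> u"
    by (cases "w = 0") (simp_all add: u_def sgn_div_norm power2_norm_eq_inner[symmetric] power2_eq_square)
  also have "\<dots> \<le> (1 - \<eta>) * (y b \<bullet> u - y a \<bullet> u)"
    using lo up by (simp add: w_def algebra_simps)
  also have "y b \<bullet> u - y a \<bullet> u \<le> spread y"
  proof -
    have "(y b - y a) \<bullet> u \<le> norm (y b - y a) * norm u" by (rule norm_cauchy_schwarz)
    also have "\<dots> \<le> norm (y b - y a)" by (simp add: u_def norm_sgn)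
    finally show ?thesis using norm_diff_le_spread[of y b a] by (simp add: inner_diff_left)
  qed
  then have "(1 - \<eta>) * (y b \<bullet> u - y a \<bullet> u) \<le> (1 - \<eta>) * spread y"
    using zeta_le_1 zeta_pos by (intro mult_left_mono) (auto simp: \<eta>_def power_le_one)
  finally show "norm (evolve s y (2 * Q * CARD('n)) i - evolve s y (2 * Q * CARD('n)) j)
      \<le> (1 - \<zeta> ^ (2 * Q * CARD('n))) * spread y"
    by (simp add: w_def \<eta>_def)
qed

lemma perturbed_spread_Suc:
  assumes "t \<ge> 1" "\<And>i. norm (z i - mix (A t) y i) \<le> \<epsilon>"
  shows "spread z \<le> spread y + 2 * \<epsilon>"
proof -
  have "spread (mix (A t) y) \<le> spread y"
  proof (rule spread_leI)
    fix i j
    show "norm (mix (A t) y i - mix (A t) y j) \<le> spread y"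
      unfolding mix_diff_const[OF assms(1)]
      by (rule norm_mix_le[OF assms(1)])
        (metis norm_mix_diff_le_spread[OF assms(1)] norm_minus_commute)
  qed
  with spread_perturb[of z "mix (A t) y" \<epsilon>] assms(2) show ?thesis by force
qed

text \<open>
  Mixing does not increase the maximum norm over the agents, so the distance from an unperturbed
  evolution with the same start is at most the sum of the perturbations.  This avoids writing
  the perturbed state as a sum over products of weight matrices.
\<close>

lemma perturbed_vs_evolve:
  assumes s: "s \<ge> 1"
    and step: "\<And>r i. s \<le> r \<Longrightarrow> r < s + k \<Longrightarrow> norm (y (Suc r) i - mix (A r) (y r) i) \<le> \<epsilon> r"
  shows "norm (y (s + k) i - evolve s (y s) k i) \<le> (\<Sum>r=s..<s + k. \<epsilon> r)"
  using step
proof (induction k arbitrary: i)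
  case (Suc k)
  have "mix (A (s + k)) (y (s + k)) i - evolve s (y s) (Suc k) i
      = mix (A (s + k)) (\<lambda>i. y (s + k) i - evolve s (y s) k i) i"
    by (simp add: mix_def sum_subtractf scaleR_diff_right)
  also have "norm \<dots> \<le> (\<Sum>r=s..<s + k. \<epsilon> r)"
    using s Suc by (intro norm_mix_le) auto
  finally have "norm (mix (A (s + k)) (y (s + k)) i - evolve s (y s) (Suc k) i)
      \<le> (\<Sum>r=s..<s + k. \<epsilon> r)" .
  moreover have "norm (y (Suc (s + k)) i - mix (A (s + k)) (y (s + k)) i) \<le> \<epsilon> (s + k)"
    using Suc.prems by simp
  ultimately show ?case
    using norm_diff_triangle_le by (fastforce simp: add.commute)
qed simp

end

text \<open>
  Summing the contraction over all starting rounds bounds the sum of \<open>d\<close> by its first \<open>B\<close> terms,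
  plus \<open>1 - \<eta>\<close> times itself, plus the windowed sums of \<open>p\<close>, in which each \<open>p r\<close> occurs at
  most \<open>B\<close> times.  The first \<open>B\<close> terms are controlled by the growth condition \<open>step\<close>, which
  alone suffices if \<open>T \<le> B\<close>.
\<close>

lemma sum_contracting_sequence:
  fixes d p :: "nat \<Rightarrow> real"
  assumes d0: "\<And>t. 0 \<le> d t" and p0: "\<And>t. 1 \<le> t \<Longrightarrow> 0 \<le> p t"
    and step: "\<And>t. 1 \<le> t \<Longrightarrow> t < T \<Longrightarrow> d (Suc t) \<le> d t + p t"
    and contract: "\<And>t. 1 \<le> t \<Longrightarrow> t + B \<le> T \<Longrightarrow> d (t + B) \<le> (1 - \<eta>) * d t + (\<Sum>r=t..<t + B. p r)"
    and \<eta>: "\<eta> \<le> 1"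
  shows "\<eta> * (\<Sum>t=1..T. d t) \<le> real B * (d 1 + 2 * (\<Sum>r=1..<T. p r))"
proof -
  define P where "P = (\<Sum>r=1..<T. p r)"
  have P0: "0 \<le> P" unfolding P_def using p0 by (intro sum_nonneg) auto
  have early: "d t \<le> d 1 + P" if "1 \<le> t" "t \<le> T" for t
  proof -
    have "d t \<le> d 1 + (\<Sum>r=1..<t. p r)"
      using that
    proof (induction t rule: dec_induct)
      case (step k)
      then show ?case using assms(3)[of k] by (simp add: sum.atLeastLessThan_Suc)
    qed simp
    also have "(\<Sum>r=1..<t. p r) \<le> P"
      unfolding P_def using that p0 by (intro sum_mono2) auto
    finally show ?thesis by simp
  qed
  show ?thesis
  proof (cases "T \<le> B")
    case True
    have "(\<Sum>t=1..T. d t) \<le> real T * (d 1 + P)"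
      using sum_bounded_above[of "{1..T}" d "d 1 + P"] early by simp
    also have "\<dots> \<le> real B * (d 1 + 2 * P)"
      using True d0[of 1] P0 by (intro mult_mono) auto
    finally have "(\<Sum>t=1..T. d t) \<le> real B * (d 1 + 2 * P)" .
    moreover have "\<eta> * (\<Sum>t=1..T. d t) \<le> 1 * (\<Sum>t=1..T. d t)"
      using \<eta> d0 by (intro mult_right_mono sum_nonneg) auto
    ultimately show ?thesis unfolding P_def by linarith
  next
    case False
    then have B: "B \<le> T" by simp
    have split: "(\<Sum>t=1..T. d t) = (\<Sum>t=1..B. d t) + (\<Sum>t=1..T - B. d (t + B))"
    proof -
      have "(\<Sum>t=1..T. d t) = (\<Sum>t=1..B. d t) + (\<Sum>t=Suc B..T. d t)"
        using B sum.ub_add_nat[of 1 B d "T - B"] by simp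
      also have "(\<Sum>t=Suc B..T. d t) = (\<Sum>t=1..T - B. d (t + B))"
        using sum.shift_bounds_cl_nat_ivl[of d 1 B "T - B"] B by simp
      finally show ?thesis .
    qed
    have head: "(\<Sum>t=1..B. d t) \<le> real B * (d 1 + P)"
      using sum_bounded_above[of "{1..B}" d "d 1 + P"] early B by simp
    \<comment> \<open>Exchange the sums: for each offset inside the window, the shifted terms are distinct
      terms of the sum of all perturbations.\<close>
    have windows: "(\<Sum>t=1..T - B. \<Sum>r=t..<t + B. p r) \<le> real B * P"
    proof -
      have "(\<Sum>t=1..T - B. \<Sum>r=t..<t + B. p r) = (\<Sum>t=1..T - B. \<Sum>k<B. p (t + k))"
      proof (rule sum.cong[OF refl])
        show "(\<Sum>r=t..<t + B. p r) = (\<Sum>k<B. p (t + k))" for t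
          using sum.atLeastLessThan_shift_0[of p t "t + B"] by (simp add: lessThan_atLeast0)
      qed
      also have "\<dots> = (\<Sum>k<B. \<Sum>t=1..T - B. p (t + k))" by (rule sum.swap)
      also have "\<dots> \<le> (\<Sum>k<B. P)"
      proof (rule sum_mono)
        fix k assume "k \<in> {..<B}"
        have "(\<Sum>t=1..T - B. p (t + k)) = (\<Sum>r=1 + k..T - B + k. p r)"
          by (rule sum.shift_bounds_cl_nat_ivl[symmetric])
        also have "\<dots> \<le> P"
          unfolding P_def using \<open>k \<in> {..<B}\<close> False p0 by (intro sum_mono2) auto
        finally show "(\<Sum>t=1..T - B. p (t + k)) \<le> P" .
      qed
      finally show ?thesis by simp
    qed
    have "(\<Sum>t=1..T - B. d (t + B)) \<le> (\<Sum>t=1..T - B. (1 - \<eta>) * d t + (\<Sum>r=t..<t + B. p r))"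
      using contract B by (intro sum_mono) auto
    also have "\<dots> \<le> (1 - \<eta>) * (\<Sum>t=1..T - B. d t) + real B * P"
      using windows by (simp add: sum.distrib sum_distrib_left)
    also have "(1 - \<eta>) * (\<Sum>t=1..T - B. d t) \<le> (1 - \<eta>) * (\<Sum>t=1..T. d t)"
      using \<eta> d0 by (intro mult_left_mono sum_mono2) auto
    finally have "(\<Sum>t=1..T - B. d (t + B)) \<le> (1 - \<eta>) * (\<Sum>t=1..T. d t) + real B * P" by simp
    with split head show ?thesis unfolding P_def[symmetric] by (simp add: algebra_simps)
  qed
qed

context consensus_network
begin

text \<open>
  The total disagreement is bounded by the initial disagreement and the total perturbation, with
  a factor that depends only on the network and not on the horizon.  It is applied once to the
  iterates and once to the gradient trackers.
\<close>

lemma sum_spread_le: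
  fixes y :: "nat \<Rightarrow> 'n \<Rightarrow> 'v::real_inner"
  assumes step: "\<And>t i. 1 \<le> t \<Longrightarrow> t < T \<Longrightarrow> norm (y (Suc t) i - mix (A t) (y t) i) \<le> \<epsilon> t"
    and "\<And>t. 1 \<le> t \<Longrightarrow> 0 \<le> \<epsilon> t"
  shows "(\<Sum>t=1..T. spread (y t))
    \<le> real (2 * Q * CARD('n)) / \<zeta> ^ (2 * Q * CARD('n)) * (spread (y 1) + 4 * (\<Sum>t=1..<T. \<epsilon> t))"
proof -
  have "\<zeta> ^ (2 * Q * CARD('n)) * (\<Sum>t=1..T. spread (y t))
      \<le> real (2 * Q * CARD('n)) * (spread (y 1) + 2 * (\<Sum>t=1..<T. 2 * \<epsilon> t))"
  proof (rule sum_contracting_sequence)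
    show "spread (y (Suc t)) \<le> spread (y t) + 2 * \<epsilon> t" if "1 \<le> t" "t < T" for t
      using perturbed_spread_Suc[OF that(1) step[OF that]] .
    show "spread (y (t + (2 * Q * CARD('n))))
        \<le> (1 - \<zeta> ^ (2 * Q * CARD('n))) * spread (y t) + (\<Sum>r=t..<t + (2 * Q * CARD('n)). 2 * \<epsilon> r)"
      if "1 \<le> t" "t + (2 * Q * CARD('n)) \<le> T" for t
    proof -
      have "spread (y (t + (2 * Q * CARD('n))))
          \<le> spread (evolve t (y t) (2 * Q * CARD('n))) + 2 * (\<Sum>r=t..<t + (2 * Q * CARD('n)). \<epsilon> r)"
        using that step by (intro spread_perturb perturbed_vs_evolve) auto
      with evolve_spread_contract[OF that(1), of "y t"] show ?thesis
        by (simp add: sum_distrib_left)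
    qed
  qed (use assms spread_nonneg zeta_le_1 zeta_pos in \<open>auto simp: power_le_one\<close>)
  also have "(\<Sum>t=1..<T. 2 * \<epsilon> t) = 2 * (\<Sum>t=1..<T. \<epsilon> t)" by (simp add: sum_distrib_left)
  finally show ?thesis
    using zeta_pos by (simp add: field_simps)
qed

end

section \<open>Frank-Wolfe steps with tracked gradients\<close>

text \<open>
  The set \<open>X\<close> may have empty interior and \<open>y\<close> may lie on its boundary, so the inequality is
  obtained from the one-sided difference quotients along the segment from \<open>y\<close> to \<open>z\<close>.
\<close>

lemma convex_on_above_gradient:
  fixes f :: "'v::real_inner \<Rightarrow> real"
  assumes f: "convex_on X f" and g: "GDERIV f y :> g" and y: "y \<in> X" and z: "z \<in> X"
  shows "f y + g \<bullet> (z - y) \<le> f z"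
proof -
  define \<phi> where "\<phi> s = f (y + s *\<^sub>R (z - y))" for s
  have "((\<lambda>s. y + s *\<^sub>R (z - y)) has_derivative (\<lambda>s. s *\<^sub>R (z - y))) (at 0)"
    by (auto intro!: derivative_eq_intros)
  from has_derivative_compose[OF this, of f "\<lambda>h. h \<bullet> g"] g
  have "(\<phi> has_derivative (\<lambda>s. s *\<^sub>R (z - y) \<bullet> g)) (at 0)"
    by (simp add: gderiv_def \<phi>_def[abs_def])
  then have "(\<phi> has_real_derivative (g \<bullet> (z - y))) (at 0)"
    unfolding has_field_derivative_def by (simp add: inner_commute mult_commute_abs)
  then have "((\<lambda>s. (\<phi> s - \<phi> 0) / s) \<longlongrightarrow> g \<bullet> (z - y)) (at 0)"
    by (simp add: DERIV_def)
  then have lim: "((\<lambda>s. (\<phi> s - \<phi> 0) / s) \<longlongrightarrow> g \<bullet> (z - y)) (at_right 0)"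
    by (rule Lim_at_imp_Lim_at_within)
  have "(\<phi> s - \<phi> 0) / s \<le> f z - f y" if "0 < s" "s < 1" for s
  proof -
    have "\<phi> s = f ((1 - s) *\<^sub>R y + s *\<^sub>R z)" by (simp add: \<phi>_def algebra_simps)
    also have "\<dots> \<le> (1 - s) * f y + s * f z"
      using convex_onD[OF f, of s y z] that y z by simp
    finally show ?thesis using that by (simp add: \<phi>_def field_simps)
  qed
  then have "\<forall>\<^sub>F s in at_right 0. (\<phi> s - \<phi> 0) / s \<le> f z - f y"
    using eventually_at_right_real[of 0 1] by (auto elim!: eventually_mono)
  from tendsto_upperbound[OF lim this] show ?thesis by simp
qed

text \<open>
  One run over a fixed horizon.  The numbers \<open>\<delta> t\<close> and \<open>\<omega> t\<close> are any bounds on the change of the losses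
  and of the gradients between the rounds \<open>t\<close> and \<open>t + 1\<close>; they stand for the terms of the function
  variation and of the gradient variation.  The bound \<open>K\<close> on the gradients of the first round
  limits the initial disagreement of the gradient trackers.
\<close>

locale dofw_co_trajectory = consensus_network A E \<zeta> Q
  for A :: "nat \<Rightarrow> real ^ 'n ^ 'n" and E :: "nat \<Rightarrow> ('n::finite \<times> 'n) set"
    and \<zeta> :: real and Q :: nat +
  fixes X :: "(real ^ 'd) set"
    and f :: "'n \<Rightarrow> nat \<Rightarrow> real ^ 'd \<Rightarrow> real"
    and g :: "'n \<Rightarrow> nat \<Rightarrow> real ^ 'd \<Rightarrow> real ^ 'd"
    and xstar :: "nat \<Rightarrow> real ^ 'd"
    and M L G K :: real
    and \<delta> \<omega> :: "nat \<Rightarrow> real"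
    and \<alpha> :: real and T :: nat
    and x xhat gbar ghat v :: "'n \<Rightarrow> nat \<Rightarrow> real ^ 'd"
  assumes convex_X: "convex X"
    and loss_convex: "\<And>i t. t \<ge> 1 \<Longrightarrow> convex_on X (f i t)"
    and loss_gradient: "\<And>i t y. t \<ge> 1 \<Longrightarrow> y \<in> X \<Longrightarrow> GDERIV (f i t) y :> g i t y"
    and minimiser: "\<And>t. t \<ge> 1 \<Longrightarrow> is_arg_min (global_loss f t) (\<lambda>y. y \<in> X) (xstar t)"
    and diameter: "\<And>y z. y \<in> X \<Longrightarrow> z \<in> X \<Longrightarrow> norm (y - z) \<le> M"
    and L_nonneg: "0 \<le> L"
    and loss_lipschitz:
      "\<And>i t y z. t \<ge> 1 \<Longrightarrow> y \<in> X \<Longrightarrow> z \<in> X \<Longrightarrow> \<bar>f i t y - f i t z\<bar> \<le> L * norm (y - z)"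
    and G_nonneg: "0 \<le> G"
    and grad_lipschitz:
      "\<And>i t y z. t \<ge> 1 \<Longrightarrow> y \<in> X \<Longrightarrow> z \<in> X \<Longrightarrow> norm (g i t y - g i t z) \<le> G * norm (y - z)"
    and grad_bound: "\<And>i y. y \<in> X \<Longrightarrow> norm (g i 1 y) \<le> K"
    and loss_change: "\<And>i t y. t \<ge> 1 \<Longrightarrow> y \<in> X \<Longrightarrow> \<bar>f i (Suc t) y - f i t y\<bar> \<le> \<delta> t"
    and grad_change: "\<And>i t y. t \<ge> 1 \<Longrightarrow> y \<in> X \<Longrightarrow> norm (g i (Suc t) y - g i t y) \<le> \<omega> t"
    and alpha: "0 < \<alpha>" "\<alpha> \<le> 1"
    and T_pos: "1 \<le> T"
    and x_initial: "\<And>i. x i 1 \<in> X"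
    and xhat_eq: "\<And>i t. 1 \<le> t \<Longrightarrow> t \<le> T \<Longrightarrow> xhat i t = mix (A t) (\<lambda>j. x j t) i"
    and gbar_1: "\<And>i. gbar i 1 = g i 1 (xhat i 1)"
    and gbar_Suc: "\<And>i t. 1 \<le> t \<Longrightarrow> t < T \<Longrightarrow>
      gbar i (Suc t) = ghat i t + (g i (Suc t) (xhat i (Suc t)) - g i t (xhat i t))"
    and ghat_eq: "\<And>i t. 1 \<le> t \<Longrightarrow> t \<le> T \<Longrightarrow> ghat i t = mix (A t) (\<lambda>j. gbar j t) i"
    and v_min: "\<And>i t. 1 \<le> t \<Longrightarrow> t \<le> T \<Longrightarrow> is_arg_min (\<lambda>y. y \<bullet> ghat i t) (\<lambda>y. y \<in> X) (v i t)"
    and x_Suc: "\<And>i t. 1 \<le> t \<Longrightarrow> t \<le> T \<Longrightarrow> x i (Suc t) = xhat i t + \<alpha> *\<^sub>R (v i t - xhat i t)"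
begin

abbreviation xbar :: "nat \<Rightarrow> real ^ 'd" where "xbar t \<equiv> mean (\<lambda>i. x i t)"
abbreviation x_spread :: "nat \<Rightarrow> real" where "x_spread t \<equiv> spread (\<lambda>i. x i t)"
abbreviation gbar_spread :: "nat \<Rightarrow> real" where "gbar_spread t \<equiv> spread (\<lambda>i. gbar i t)"
abbreviation mean_loss :: "nat \<Rightarrow> real ^ 'd \<Rightarrow> real" where
  "mean_loss t y \<equiv> mean (\<lambda>i. f i t y)"
abbreviation mean_grad :: "nat \<Rightarrow> real ^ 'd \<Rightarrow> real ^ 'd" where
  "mean_grad t y \<equiv> mean (\<lambda>i. g i t y)"

lemma M_nonneg: "0 \<le> M"
  using diameter[OF x_initial x_initial, of undefined undefined] by simp

lemma v_in_X: "1 \<le> t \<Longrightarrow> t \<le> T \<Longrightarrow> v i t \<in> X"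
  using v_min by (auto simp: is_arg_min_def)

lemma v_least: "1 \<le> t \<Longrightarrow> t \<le> T \<Longrightarrow> y \<in> X \<Longrightarrow> v i t \<bullet> ghat i t \<le> y \<bullet> ghat i t"
  using v_min[of t i] by (auto simp: is_arg_min_def not_less)

lemma x_in_X: "1 \<le> t \<Longrightarrow> t \<le> Suc T \<Longrightarrow> x i t \<in> X"
proof (induction t arbitrary: i rule: dec_induct)
  case base
  show ?case by (rule x_initial)
next
  case (step t)
  then have "xhat i t \<in> X" by (simp add: xhat_eq mix_in_convex convex_X)
  with step alpha v_in_X[of t i] convexD_alt[OF convex_X, of "xhat i t" "v i t" \<alpha>] show ?case
    by (simp add: x_Suc algebra_simps)
qed

lemma xhat_in_X: "1 \<le> t \<Longrightarrow> t \<le> T \<Longrightarrow> xhat i t \<in> X"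
  by (simp add: xhat_eq mix_in_convex convex_X x_in_X)

lemma xbar_in_X: "1 \<le> t \<Longrightarrow> t \<le> Suc T \<Longrightarrow> xbar t \<in> X"
  by (simp add: mean_in_convex convex_X x_in_X)

lemma norm_x_step: "1 \<le> t \<Longrightarrow> t \<le> T \<Longrightarrow> norm (x i (Suc t) - xhat i t) \<le> \<alpha> * M"
  using diameter[OF v_in_X[of t i] xhat_in_X[of t i]] alpha by (simp add: x_Suc)

lemma sum_step_le: "(\<Sum>t=1..<T. \<alpha> * M) \<le> \<alpha> * M * real T"
proof -
  have "(\<Sum>t=1..<T. \<alpha> * M) = real (T - 1) * (\<alpha> * M)" by simp
  also have "\<dots> \<le> real T * (\<alpha> * M)" using alpha M_nonneg by (intro mult_right_mono) auto
  finally show ?thesis by (simp add: mult.commute)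
qed

text \<open>
  The iterates follow the mixing dynamics up to the step, whose length is at most \<open>\<alpha> * M\<close>.
\<close>

lemma sum_x_spread_le:
  "(\<Sum>t=1..T. x_spread t)
    \<le> real (2 * Q * CARD('n)) / \<zeta> ^ (2 * Q * CARD('n)) * (M + 4 * (\<alpha> * M * real T))"
proof -
  have "(\<Sum>t=1..T. x_spread t) \<le> real (2 * Q * CARD('n)) / \<zeta> ^ (2 * Q * CARD('n))
      * (x_spread 1 + 4 * (\<Sum>t=1..<T. \<alpha> * M))"
  proof (rule sum_spread_le)
    show "norm (x i (Suc t) - mix (A t) (\<lambda>i. x i t) i) \<le> \<alpha> * M" if "1 \<le> t" "t < T" for t i
      using norm_x_step[of t i] that by (simp add: xhat_eq)
  qed (use alpha M_nonneg in simp)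
  also have "\<dots> \<le> real (2 * Q * CARD('n)) / \<zeta> ^ (2 * Q * CARD('n)) * (M + 4 * (\<alpha> * M * real T))"
  proof (intro mult_left_mono add_mono order_refl)
    show "x_spread 1 \<le> M" by (rule spread_leI) (intro diameter x_initial)
    show "(\<Sum>t=1..<T. \<alpha> * M) \<le> \<alpha> * M * real T" by (rule sum_step_le)
  qed (use zeta_pos in auto)
  finally show ?thesis .
qed

text \<open>
  The invariant of gradient tracking: the corrections telescope, and mixing preserves averages.
\<close>

lemma mean_gbar: "1 \<le> t \<Longrightarrow> t \<le> T \<Longrightarrow> mean (\<lambda>i. gbar i t) = mean (\<lambda>i. g i t (xhat i t))"
proof (induction t rule: dec_induct)
  case base
  show ?case by (simp add: gbar_1[simplified])
next
  case (step t)
  then have "mean (\<lambda>i. ghat i t) = mean (\<lambda>i. gbar i t)"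
    using mean_mix[of t "\<lambda>i. gbar i t"] by (simp add: ghat_eq)
  with step show ?case by (simp add: gbar_Suc mean_add mean_diff)
qed

text \<open>
  The correction added to a tracker consists of the change of the loss and of the
  movement of the query point.  That movement is the step \<open>\<alpha> * M\<close> followed by one mixing at
  round \<open>t + 1\<close>, so the disagreement of the iterates enters the perturbation of the trackers.
\<close>

lemma gbar_step:
  assumes "1 \<le> t" "t < T"
  shows "norm (gbar i (Suc t) - ghat i t) \<le> \<omega> t + G * (x_spread (Suc t) + \<alpha> * M)"
proof -
  have in_X: "xhat i t \<in> X" "xhat i (Suc t) \<in> X" using assms xhat_in_X by auto
  have "norm (xhat i (Suc t) - x i (Suc t)) \<le> x_spread (Suc t)"
    using norm_mix_diff_le_spread[of "Suc t" "\<lambda>j. x j (Suc t)" i i] assms by (simp add: xhat_eq)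
  moreover have "norm (x i (Suc t) - xhat i t) \<le> \<alpha> * M"
    using norm_x_step assms by simp
  ultimately have "norm (xhat i (Suc t) - xhat i t) \<le> x_spread (Suc t) + \<alpha> * M"
    by (rule norm_diff_triangle_le)
  then have "norm (g i t (xhat i (Suc t)) - g i t (xhat i t)) \<le> G * (x_spread (Suc t) + \<alpha> * M)"
    using grad_lipschitz[OF assms(1) in_X(2,1), of i] G_nonneg by (meson mult_left_mono order_trans)
  with grad_change[OF assms(1) in_X(2), of i]
  have "norm (g i (Suc t) (xhat i (Suc t)) - g i t (xhat i t))
      \<le> \<omega> t + G * (x_spread (Suc t) + \<alpha> * M)"
    by (rule norm_diff_triangle_le)
  then show ?thesis using assms by (simp add: gbar_Suc)
qed

lemma sum_gbar_spread_le:
  "(\<Sum>t=1..T. gbar_spread t)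
    \<le> real (2 * Q * CARD('n)) / \<zeta> ^ (2 * Q * CARD('n))
      * (2 * K + 4 * ((\<Sum>t=1..T. \<omega> t) + G * ((\<Sum>t=1..T. x_spread t) + \<alpha> * M * real T)))"
proof -
  have \<omega>: "0 \<le> \<omega> t" if "1 \<le> t" for t
    using grad_change[OF that x_initial[of undefined], of undefined] by (smt (verit) norm_ge_zero)
  have "(\<Sum>t=1..T. gbar_spread t) \<le> real (2 * Q * CARD('n)) / \<zeta> ^ (2 * Q * CARD('n))
      * (gbar_spread 1 + 4 * (\<Sum>t=1..<T. \<omega> t + G * (x_spread (Suc t) + \<alpha> * M)))"
  proof (rule sum_spread_le)
    show "norm (gbar i (Suc t) - mix (A t) (\<lambda>i. gbar i t) i)
        \<le> \<omega> t + G * (x_spread (Suc t) + \<alpha> * M)" if "1 \<le> t" "t < T" for t i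
      using gbar_step[of t i] that by (simp add: ghat_eq)
  qed (use alpha M_nonneg G_nonneg \<omega> in \<open>auto intro!: add_nonneg_nonneg mult_nonneg_nonneg spread_nonneg\<close>)
  also have "\<dots> \<le> real (2 * Q * CARD('n)) / \<zeta> ^ (2 * Q * CARD('n))
      * (2 * K + 4 * ((\<Sum>t=1..T. \<omega> t) + G * ((\<Sum>t=1..T. x_spread t) + \<alpha> * M * real T)))"
  proof (intro mult_left_mono add_mono order_refl)
    show "gbar_spread 1 \<le> 2 * K"
    proof (rule spread_leI)
      fix i j
      show "norm (gbar i 1 - gbar j 1) \<le> 2 * K"
        unfolding gbar_1
        using grad_bound[OF xhat_in_X, of 1 i i] grad_bound[OF xhat_in_X, of 1 j j] T_pos
          norm_triangle_ineq4[of "g i 1 (xhat i 1)" "g j 1 (xhat j 1)"]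
        by auto
    qed
    have "(\<Sum>t=1..<T. x_spread (Suc t)) = (\<Sum>t=Suc 1..<Suc T. x_spread t)"
      by (rule sum.shift_bounds_Suc_ivl[symmetric])
    also have "\<dots> \<le> (\<Sum>t=1..T. x_spread t)"
      by (rule sum_mono2) (auto simp: spread_nonneg)
    finally have "(\<Sum>t=1..<T. x_spread (Suc t)) \<le> (\<Sum>t=1..T. x_spread t)" .
    with sum_step_le have "G * (\<Sum>t=1..<T. x_spread (Suc t) + \<alpha> * M)
        \<le> G * ((\<Sum>t=1..T. x_spread t) + \<alpha> * M * real T)"
      using G_nonneg unfolding sum.distrib by (intro mult_left_mono add_mono)
    moreover have "(\<Sum>t=1..<T. \<omega> t) \<le> (\<Sum>t=1..T. \<omega> t)"
      using \<omega> by (intro sum_mono2) auto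
    ultimately show "(\<Sum>t=1..<T. \<omega> t + G * (x_spread (Suc t) + \<alpha> * M))
        \<le> (\<Sum>t=1..T. \<omega> t) + G * ((\<Sum>t=1..T. x_spread t) + \<alpha> * M * real T)"
      unfolding sum.distrib[of \<omega> "\<lambda>t. G * (x_spread (Suc t) + \<alpha> * M)"] sum_distrib_left[symmetric]
      by linarith
  qed (use zeta_pos in auto)
  finally show ?thesis .
qed

lemma gradient_tracking_error:
  assumes "1 \<le> t" "t \<le> T"
  shows "norm (mean_grad t (xbar t) - ghat i t) \<le> G * x_spread t + gbar_spread t"
proof -
  have "norm (mean (\<lambda>i. g i t (xbar t) - g i t (xhat i t))) \<le> G * x_spread t"
  proof (rule norm_mean_le)
    fix i
    have "norm (xbar t - xhat i t) \<le> x_spread t"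
      using norm_mean_diff_mix_le_spread[of t "\<lambda>j. x j t"] assms by (simp add: xhat_eq)
    with grad_lipschitz[OF assms(1) xbar_in_X xhat_in_X, of t t i i] assms G_nonneg
    show "norm (g i t (xbar t) - g i t (xhat i t)) \<le> G * x_spread t"
      by (meson le_SucI mult_left_mono order_trans)
  qed
  then have "norm (mean_grad t (xbar t) - mean (\<lambda>i. gbar i t)) \<le> G * x_spread t"
    by (simp add: mean_diff mean_gbar[OF assms])
  moreover have "norm (mean (\<lambda>i. gbar i t) - ghat i t) \<le> gbar_spread t"
    using norm_mean_diff_mix_le_spread[of t "\<lambda>j. gbar j t"] assms by (simp add: ghat_eq)
  ultimately show ?thesis by (rule norm_diff_triangle_le)
qed

lemma mean_loss_above_gradient:
  assumes "1 \<le> t" "y \<in> X" "z \<in> X"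
  shows "mean_loss t y + mean_grad t y \<bullet> (z - y) \<le> mean_loss t z"
proof -
  have "mean (\<lambda>i. f i t y + g i t y \<bullet> (z - y)) \<le> mean_loss t z"
    using assms by (intro mean_mono convex_on_above_gradient[OF loss_convex loss_gradient])
  then show ?thesis by (simp add: mean_add mean_inner)
qed

text \<open>
  Applying \<open>mean_loss_above_gradient\<close> at \<open>z\<close> instead of \<open>y\<close> yields the smoothness inequality by
  Cauchy-Schwarz, without integrating along the segment.  The constant is \<open>G\<close> instead of \<open>G / 2\<close>,
  which only affects the final constant.
\<close>

lemma mean_loss_descent:
  assumes "1 \<le> t" "y \<in> X" "z \<in> X"
  shows "mean_loss t z \<le> mean_loss t y + mean_grad t y \<bullet> (z - y) + G * (norm (z - y))\<^sup>2"
proof -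
  have "norm (mean_grad t z - mean_grad t y) \<le> G * norm (z - y)"
    unfolding mean_diff[symmetric] using assms by (intro norm_mean_le grad_lipschitz)
  then have "norm (mean_grad t z - mean_grad t y) * norm (z - y) \<le> G * (norm (z - y))\<^sup>2"
    by (simp add: mult_right_mono power2_eq_square mult.assoc[symmetric])
  then have "(mean_grad t z - mean_grad t y) \<bullet> (z - y) \<le> G * (norm (z - y))\<^sup>2"
    using norm_cauchy_schwarz order_trans by blast
  with mean_loss_above_gradient[OF assms(1,3,2)] show ?thesis
    by (simp add: inner_diff_left inner_diff_right)
qed

lemma xstar_in_X: "1 \<le> t \<Longrightarrow> xstar t \<in> X"
  using minimiser by (auto simp: is_arg_min_def)

lemma global_loss_eq: "global_loss f t y = real CARD('n) * mean_loss t y"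
  by (simp add: global_loss_def mean_def)

lemma xstar_least: "1 \<le> t \<Longrightarrow> y \<in> X \<Longrightarrow> mean_loss t (xstar t) \<le> mean_loss t y"
  using minimiser[of t] by (auto simp: is_arg_min_def global_loss_eq not_less)

lemma mean_loss_lipschitz:
  assumes "1 \<le> t" "y \<in> X" "z \<in> X"
  shows "\<bar>mean_loss t y - mean_loss t z\<bar> \<le> L * norm (y - z)"
  unfolding mean_diff[symmetric] real_norm_def[symmetric]
  using assms by (intro norm_mean_le) (simp add: loss_lipschitz)

lemma mean_loss_change:
  assumes "1 \<le> t" "y \<in> X"
  shows "\<bar>mean_loss (Suc t) y - mean_loss t y\<bar> \<le> \<delta> t"
  unfolding mean_diff[symmetric] real_norm_def[symmetric]
  using assms by (intro norm_mean_le) (simp add: loss_change)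

text \<open>
  The gap is taken for the average loss instead of the global one, so that the number of agents
  enters only as a factor of the final bound.
\<close>

definition gap :: "nat \<Rightarrow> real" where
  "gap t = mean_loss t (xbar t) - mean_loss t (xstar t)"

text \<open>
  The Frank-Wolfe argument for the average iterate, which moves by \<open>\<alpha> *\<^sub>R (vbar - xbar t)\<close>.  With an
  exact gradient, moving towards the minimiser of the linearised loss decreases the gap by the
  factor \<open>1 - \<alpha>\<close>, up to the quadratic term.  Here \<open>v i t\<close> minimises the product with the
  tracker \<open>ghat i t\<close>, which costs the tracking error times the diameter.  Replacing the loss of
  round \<open>t\<close> and its minimiser by those of round \<open>t + 1\<close> costs \<open>\<delta> t\<close> twice.
\<close>

lemma gap_recursion:
  assumes t: "1 \<le> t" "t \<le> T"
  shows "\<alpha> * gap t \<le> gap t - gap (Suc t) + 2 * \<delta> t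
    + \<alpha> * M * (G * x_spread t + gbar_spread t) + G * (\<alpha> * M)\<^sup>2"
proof -
  define e where "e = G * x_spread t + gbar_spread t"
  define p where "p = mean_grad t (xbar t)"
  define vbar where "vbar = mean (\<lambda>i. v i t)"
  have in_X: "xbar t \<in> X" "xbar (Suc t) \<in> X" "vbar \<in> X" "xstar t \<in> X" "xstar (Suc t) \<in> X"
    using t xbar_in_X xstar_in_X v_in_X by (auto simp: vbar_def mean_in_convex convex_X)
  have "mean (\<lambda>i. xhat i t) = xbar t"
    using mean_mix[of t "\<lambda>i. x i t"] t by (simp add: xhat_eq)
  then have move: "xbar (Suc t) - xbar t = \<alpha> *\<^sub>R (vbar - xbar t)"
    using t by (simp add: x_Suc mean_add mean_scaleR mean_diff vbar_def)
  \<comment> \<open>The linear subproblem is solved for the tracker; the comparison point is the minimiser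
   of the current loss.\<close>
  have "p \<bullet> (v i t - xstar t) \<le> e * M" for i
  proof -
    have "p \<bullet> (v i t - xstar t)
        = (p - ghat i t) \<bullet> (v i t - xstar t) + (v i t \<bullet> ghat i t - xstar t \<bullet> ghat i t)"
      by (simp add: inner_diff_left inner_diff_right inner_commute)
    also have "\<dots> \<le> norm (p - ghat i t) * norm (v i t - xstar t) + 0"
      using v_least[OF t in_X(4), of i] by (intro add_mono norm_cauchy_schwarz) simp
    also have "\<dots> \<le> e * M"
      using gradient_tracking_error[OF t, of i] diameter[OF v_in_X[OF t] in_X(4)]
      unfolding p_def e_def by (simp add: mult_mono')
    finally show ?thesis .
  qed
  then have "mean (\<lambda>i. (v i t - xstar t) \<bullet> p) \<le> mean (\<lambda>i::'n. e * M)"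
    by (intro mean_mono) (simp add: inner_commute)
  then have "p \<bullet> (vbar - xstar t) \<le> e * M"
    unfolding mean_inner[symmetric] mean_diff mean_const vbar_def by (simp add: inner_commute)
  moreover have "p \<bullet> (xstar t - xbar t) \<le> - gap t"
    using mean_loss_above_gradient[OF t(1) in_X(1,4)] by (simp add: p_def gap_def)
  ultimately have "p \<bullet> (vbar - xbar t) \<le> e * M - gap t"
    by (simp add: inner_diff_right)
  then have "p \<bullet> (xbar (Suc t) - xbar t) \<le> \<alpha> * (e * M - gap t)"
    unfolding move using alpha by simp
  moreover have "G * (norm (xbar (Suc t) - xbar t))\<^sup>2 \<le> G * (\<alpha> * M)\<^sup>2"
    unfolding move using diameter[OF in_X(3,1)] alpha G_nonneg
    by (intro mult_left_mono power_mono) auto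
  ultimately have "mean_loss t (xbar (Suc t))
      \<le> mean_loss t (xbar t) + \<alpha> * (e * M - gap t) + G * (\<alpha> * M)\<^sup>2"
    using mean_loss_descent[OF t(1) in_X(1,2)] unfolding p_def by linarith
  moreover have "gap (Suc t) \<le> mean_loss t (xbar (Suc t)) - mean_loss t (xstar t) + 2 * \<delta> t"
    using mean_loss_change[OF t(1) in_X(2)] mean_loss_change[OF t(1) in_X(5)]
      xstar_least[OF t(1) in_X(5)] unfolding gap_def by linarith
  ultimately show ?thesis unfolding e_def[symmetric] by (simp add: gap_def algebra_simps)
qed

text \<open>
  The gaps telescope: the last one is nonnegative, and the first one is at most \<open>L * M\<close>.
\<close>

lemma sum_gap_le:
  "(\<Sum>t=1..T. gap t) \<le> (L * M + 2 * (\<Sum>t=1..T. \<delta> t)) / \<alpha>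
    + M * (G * (\<Sum>t=1..T. x_spread t) + (\<Sum>t=1..T. gbar_spread t)) + G * M\<^sup>2 * (\<alpha> * real T)"
proof -
  have "gap 1 \<le> L * norm (xbar 1 - xstar 1)"
    using mean_loss_lipschitz[of 1 "xbar 1" "xstar 1"] T_pos xbar_in_X xstar_in_X
    by (simp add: gap_def)
  also have "\<dots> \<le> L * M"
    using T_pos xbar_in_X xstar_in_X L_nonneg by (intro mult_left_mono diameter) auto
  finally have first: "gap 1 \<le> L * M" .
  have last: "0 \<le> gap (Suc T)"
    using xstar_least[of "Suc T" "xbar (Suc T)"] xbar_in_X[of "Suc T"] by (simp add: gap_def)
  have "\<alpha> * (\<Sum>t=1..T. gap t) \<le> (\<Sum>t=1..T. gap t - gap (Suc t) + 2 * \<delta> t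
      + \<alpha> * M * (G * x_spread t + gbar_spread t) + G * (\<alpha> * M)\<^sup>2)"
    unfolding sum_distrib_left by (intro sum_mono gap_recursion) auto
  also have "\<dots> = (\<Sum>t=1..T. gap t - gap (Suc t)) + 2 * (\<Sum>t=1..T. \<delta> t)
      + \<alpha> * M * (G * (\<Sum>t=1..T. x_spread t) + (\<Sum>t=1..T. gbar_spread t)) + real T * (G * (\<alpha> * M)\<^sup>2)"
    by (simp add: sum.distrib sum_distrib_left distrib_left)
  also have "(\<Sum>t=1..T. gap t - gap (Suc t)) = gap 1 - gap (Suc T)"
    using sum_Suc_diff[of 1 T "\<lambda>t. - gap t"] by simp
  finally have "\<alpha> * (\<Sum>t=1..T. gap t) \<le> L * M + 2 * (\<Sum>t=1..T. \<delta> t)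
      + \<alpha> * (M * (G * (\<Sum>t=1..T. x_spread t) + (\<Sum>t=1..T. gbar_spread t)) + G * M\<^sup>2 * (\<alpha> * real T))"
    using first last by (simp add: algebra_simps power2_eq_square)
  then show ?thesis using alpha by (simp add: field_simps)
qed

text \<open>
  An agent pays the gap of the average iterate plus its distance from it, by the Lipschitz bound.
\<close>

lemma regret_le_spreads:
  "dynamic_regret f xstar x j T \<le> real CARD('n) *
    ((L + M * G) * (\<Sum>t=1..T. x_spread t) + M * (\<Sum>t=1..T. gbar_spread t)
     + (L * M + 2 * (\<Sum>t=1..T. \<delta> t)) / \<alpha> + G * M\<^sup>2 * (\<alpha> * real T))"
proof -
  have "mean_loss t (x j t) - mean_loss t (xbar t) \<le> L * x_spread t" if "t \<in> {1..T}" for t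
  proof -
    have "mean_loss t (x j t) - mean_loss t (xbar t) \<le> L * norm (x j t - xbar t)"
      using mean_loss_lipschitz[of t "x j t" "xbar t"] x_in_X[of t j] xbar_in_X[of t] that by auto
    also have "\<dots> \<le> L * x_spread t"
      using norm_mean_diff_le_spread[of "\<lambda>i. x i t" j] L_nonneg
      by (intro mult_left_mono) (simp_all add: norm_minus_commute)
    finally show ?thesis .
  qed
  then have "(\<Sum>t=1..T. mean_loss t (x j t) - mean_loss t (xbar t)) \<le> L * (\<Sum>t=1..T. x_spread t)"
    unfolding sum_distrib_left by (intro sum_mono)
  moreover have "dynamic_regret f xstar x j T = real CARD('n) *
      ((\<Sum>t=1..T. mean_loss t (x j t) - mean_loss t (xbar t)) + (\<Sum>t=1..T. gap t))"
    by (simp add: dynamic_regret_def global_loss_eq gap_def sum_subtractf sum_distrib_left[symmetric]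
        right_diff_distrib[symmetric])
  ultimately have "dynamic_regret f xstar x j T
      \<le> real CARD('n) * (L * (\<Sum>t=1..T. x_spread t) + (\<Sum>t=1..T. gap t))"
    by (simp add: mult_left_mono)
  also have "\<dots> \<le> real CARD('n) * (L * (\<Sum>t=1..T. x_spread t)
      + ((L * M + 2 * (\<Sum>t=1..T. \<delta> t)) / \<alpha>
        + M * (G * (\<Sum>t=1..T. x_spread t) + (\<Sum>t=1..T. gbar_spread t)) + G * M\<^sup>2 * (\<alpha> * real T)))"
    by (intro mult_left_mono add_left_mono sum_gap_le) simp
  finally show ?thesis by (simp add: algebra_simps)
qed

end

section \<open>The regret bound for the balanced step size\<close>

lemma le_MAX_SUP:
  fixes h :: "'n::finite \<Rightarrow> 'a \<Rightarrow> real"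
  assumes "\<And>i. bdd_above (h i ` X)" "y \<in> X"
  shows "h i y \<le> (MAX i. SUP y\<in>X. h i y)"
proof -
  have "h i y \<le> (SUP y\<in>X. h i y)" by (rule cSUP_upper[OF assms(2,1)])
  also have "\<dots> \<le> (MAX i. SUP y\<in>X. h i y)" by (rule Max_ge) auto
  finally show ?thesis .
qed

text \<open>
  The suprema in the two variations are real-valued suprema, hence meaningful only for sets that
  are bounded above.  Lipschitz continuity on a set of finite diameter provides this.
\<close>

lemma bdd_above_norm_diff_lipschitz:
  fixes p q :: "'a::real_normed_vector \<Rightarrow> 'b::real_normed_vector"
  assumes diam: "\<And>y z. y \<in> X \<Longrightarrow> z \<in> X \<Longrightarrow> norm (y - z) \<le> M" and c: "0 \<le> c"
    and p: "\<And>y z. y \<in> X \<Longrightarrow> z \<in> X \<Longrightarrow> norm (p y - p z) \<le> c * norm (y - z)"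
    and q: "\<And>y z. y \<in> X \<Longrightarrow> z \<in> X \<Longrightarrow> norm (q y - q z) \<le> c * norm (y - z)"
  shows "bdd_above ((\<lambda>y. norm (p y - q y)) ` X)"
proof (cases "X = {}")
  case False
  then obtain z where z: "z \<in> X" by auto
  have "norm (p y - q y) \<le> norm (p z - q z) + 2 * (c * M)" if y: "y \<in> X" for y
  proof -
    have le: "c * norm (y - z) \<le> c * M" using diam[OF y z] c by (rule mult_left_mono)
    have "p y - q y = (p z - q z) + ((p y - p z) - (q y - q z))" by simp
    then have "norm (p y - q y) \<le> norm (p z - q z) + (norm (p y - p z) + norm (q y - q z))"
      by (metis add_left_mono norm_triangle_ineq norm_triangle_ineq4 order_trans)
    with p[OF y z] q[OF y z] le show ?thesis by linarith
  qed
  then show ?thesis by (rule bdd_aboveI2)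
qed simp

theorem corollary1:
  fixes X :: "(real ^ 'd) set"
    and f :: "'n::finite \<Rightarrow> nat \<Rightarrow> real ^ 'd \<Rightarrow> real"
    and g :: "'n \<Rightarrow> nat \<Rightarrow> real ^ 'd \<Rightarrow> real ^ 'd"
    and xstar :: "nat \<Rightarrow> real ^ 'd"
    and E :: "nat \<Rightarrow> ('n \<times> 'n) set"
    and A :: "nat \<Rightarrow> real ^ 'n ^ 'n"
    and x1 :: "'n \<Rightarrow> real ^ 'd"
    and x :: "nat \<Rightarrow> 'n \<Rightarrow> nat \<Rightarrow> real ^ 'd"
    and \<zeta> M L G \<gamma> :: real
    and Q :: nat
  assumes X: "X \<noteq> {}" "convex X" "compact X"
    and loss_convex: "\<And>i t. t \<ge> 1 \<Longrightarrow> convex_on X (f i t)"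
    and loss_gradient: "\<And>i t y. t \<ge> 1 \<Longrightarrow> y \<in> X \<Longrightarrow> GDERIV (f i t) y :> g i t y"
    and minimiser: "\<And>t. t \<ge> 1 \<Longrightarrow> is_arg_min (global_loss f t) (\<lambda>y. y \<in> X) (xstar t)"
    and weights_pos: "\<And>t i j. t \<ge> 1 \<Longrightarrow> j \<in> in_neighbours (E t) i \<Longrightarrow> A t $ i $ j > 0"
    and weights_zero: "\<And>t i j. t \<ge> 1 \<Longrightarrow> j \<notin> in_neighbours (E t) i \<Longrightarrow> A t $ i $ j = 0"
    and zeta: "\<zeta> > 0" "\<And>t i j. t \<ge> 1 \<Longrightarrow> A t $ i $ j > 0 \<Longrightarrow> A t $ i $ j > \<zeta>"
    and row_sums: "\<And>t i. t \<ge> 1 \<Longrightarrow> (\<Sum>j\<in>UNIV. A t $ i $ j) = 1"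
    and column_sums: "\<And>t j. t \<ge> 1 \<Longrightarrow> (\<Sum>i\<in>UNIV. A t $ i $ j) = 1"
    and connected: "Q > 0"
      "\<And>k. strongly_connected (with_proj (union_graph E {k * Q + 1 .. (k + 1) * Q}))"
    and diameter: "\<And>y z. y \<in> X \<Longrightarrow> z \<in> X \<Longrightarrow> norm (y - z) \<le> M"
    and loss_lipschitz: "L > 0"
      "\<And>i t y z. t \<ge> 1 \<Longrightarrow> y \<in> X \<Longrightarrow> z \<in> X \<Longrightarrow> \<bar>f i t y - f i t z\<bar> \<le> L * norm (y - z)"
    and grad_lipschitz:
      "\<And>i t y z. t \<ge> 1 \<Longrightarrow> y \<in> X \<Longrightarrow> z \<in> X \<Longrightarrow> norm (g i t y - g i t z) \<le> G * norm (y - z)"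
    and H_sublinear: "fun_variation X f \<in> o(\<lambda>T. real T)"
    and D_sublinear: "grad_variation X g \<in> o(\<lambda>T. real T)"
    and initial: "\<And>i. x1 i \<in> X"
    and gamma: "\<gamma> > 0"
      "\<And>T. T \<ge> 2 \<Longrightarrow> \<gamma> * sqrt ((fun_variation X f T + 1) / real T) \<le> 1"
    and run: "\<And>T. T \<ge> 2 \<Longrightarrow>
      dofw_co_run X E A g (\<gamma> * sqrt ((fun_variation X f T + 1) / real T)) T x1 (x T)"
  shows "\<forall>j. \<exists>C. \<forall>T\<ge>2. dynamic_regret f xstar (x T) j T
           \<le> C * (sqrt (real T * (1 + fun_variation X f T)) + grad_variation X g T)"
proof -
  interpret consensus_network A E \<zeta> Q
    by standard (use weights_pos weights_zero zeta row_sums column_sums connected in auto)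
  \<comment> \<open>A negative Lipschitz constant is possible only if \<open>X\<close> is a single point.\<close>
  define G' where "G' = max G 0"
  have G': "0 \<le> G'" by (simp add: G'_def)
  have grad_lipschitz': "norm (g i t y - g i t z) \<le> G' * norm (y - z)"
    if "t \<ge> 1" "y \<in> X" "z \<in> X" for i t y z
    using grad_lipschitz[OF that, of i] mult_right_mono[of G G' "norm (y - z)"]
    by (simp add: G'_def)
  obtain z where z: "z \<in> X" using X(1) by auto
  have M: "0 \<le> M" using diameter[OF z z] by simp
  define K where "K = (\<Sum>i\<in>UNIV. norm (g i 1 z)) + G' * M"
  have K: "norm (g i 1 y) \<le> K" if "y \<in> X" for i y
  proof -
    have "norm (g i 1 y) \<le> norm (g i 1 z) + norm (g i 1 y - g i 1 z)"
      by (rule norm_triangle_sub)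
    also have "norm (g i 1 z) \<le> (\<Sum>i\<in>UNIV. norm (g i 1 z))" by (rule member_le_sum) auto
    also have "norm (g i 1 y - g i 1 z) \<le> G' * M"
      using grad_lipschitz'[OF _ that z] mult_left_mono[OF diameter[OF that z] G']
      by (meson order_refl order_trans)
    finally show ?thesis by (simp add: K_def)
  qed
  have K0: "0 \<le> K" using K[OF z] norm_ge_zero order_trans by blast
  define \<delta> where "\<delta> t = (MAX i. SUP y\<in>X. \<bar>f i (t + 1) y - f i t y\<bar>)" for t
  define \<omega> where "\<omega> t = (MAX i. SUP y\<in>X. norm (g i (t + 1) y - g i t y))" for t
  have \<delta>: "\<bar>f i (Suc t) y - f i t y\<bar> \<le> \<delta> t" if "t \<ge> 1" "y \<in> X" for i t y
  proof -
    have "bdd_above ((\<lambda>y. \<bar>f i (t + 1) y - f i t y\<bar>) ` X)" for i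
      using bdd_above_norm_diff_lipschitz[of X M L "f i (t + 1)" "f i t"]
        diameter loss_lipschitz that(1) by simp
    from le_MAX_SUP[of "\<lambda>i y. \<bar>f i (t + 1) y - f i t y\<bar>", OF this that(2), of i]
    show ?thesis by (simp add: \<delta>_def)
  qed
  have \<omega>: "norm (g i (Suc t) y - g i t y) \<le> \<omega> t" if "t \<ge> 1" "y \<in> X" for i t y
  proof -
    have "bdd_above ((\<lambda>y. norm (g i (t + 1) y - g i t y)) ` X)" for i
      using bdd_above_norm_diff_lipschitz[of X M G' "g i (t + 1)" "g i t"]
        diameter grad_lipschitz' G' that(1) by simp
    from le_MAX_SUP[of "\<lambda>i y. norm (g i (t + 1) y - g i t y)", OF this that(2), of i]
    show ?thesis by (simp add: \<omega>_def)
  qed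
  have H_eq: "fun_variation X f T = (\<Sum>t=1..T. \<delta> t)" for T
    by (simp add: fun_variation_def \<delta>_def)
  have D_eq: "grad_variation X g T = (\<Sum>t=1..T. \<omega> t)" for T
    by (simp add: grad_variation_def \<omega>_def)
  have H0: "0 \<le> fun_variation X f T" for T
    unfolding H_eq using \<delta>[OF _ z] by (intro sum_nonneg) (force intro: order_trans[OF abs_ge_zero])
  have D0: "0 \<le> grad_variation X g T" for T
    unfolding D_eq using \<omega>[OF _ z] by (intro sum_nonneg) (force intro: order_trans[OF norm_ge_zero])

  define W where "W = real (2 * Q * CARD('n)) / \<zeta> ^ (2 * Q * CARD('n))"
  have W: "0 \<le> W" using zeta(1) by (simp add: W_def)
  \<comment> \<open>With \<open>R\<close> for \<open>sqrt (T * (1 + H))\<close> and \<open>D\<close> for the gradient variation, \<open>a * R\<close> bounds the total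
    disagreement of the iterates and \<open>b * (R + D)\<close> that of the trackers, since \<open>\<alpha> * T = \<gamma> * R\<close>, \<open>1 \<le> R\<close>
    and \<open>0 \<le> D\<close>.\<close>
  define a where "a = W * M * (1 + 4 * \<gamma>)"
  define b where "b = W * (2 * K + 4 + 4 * G' * (a + \<gamma> * M))"
  define C where "C = real CARD('n) *
    ((L + M * G') * a + M * b + (L * M + 2) / \<gamma> + G' * M\<^sup>2 * \<gamma>)"
  have nonneg: "0 \<le> a" "0 \<le> b" "0 \<le> L + M * G'" "0 \<le> (L * M + 2) / \<gamma>" "0 \<le> G' * M\<^sup>2 * \<gamma>"
    using W M G' K0 gamma(1) loss_lipschitz(1) by (auto simp: a_def b_def)
  have "dynamic_regret f xstar (x T) j T
      \<le> C * (sqrt (real T * (1 + fun_variation X f T)) + grad_variation X g T)"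
    if T: "T \<ge> 2" for j T
  proof -
    define H where "H = fun_variation X f T"
    define D where "D = grad_variation X g T"
    define \<alpha> where "\<alpha> = \<gamma> * sqrt ((H + 1) / real T)"
    define R where "R = sqrt (real T * (1 + H))"
    have \<alpha>: "0 < \<alpha>" "\<alpha> \<le> 1"
      using gamma H0[of T] T by (auto simp: \<alpha>_def H_def intro!: divide_pos_pos add_nonneg_pos)
    have "1 * 1 \<le> real T * (1 + H)" using T H0[of T] by (intro mult_mono) (auto simp: H_def)
    then have R1: "1 \<le> R" by (simp add: R_def)
    have \<alpha>T: "\<alpha> * real T = \<gamma> * R"
    proof -
      have "sqrt ((H + 1) / real T) * real T = sqrt ((H + 1) / real T) * sqrt ((real T)\<^sup>2)"
        by simp
      also have "\<dots> = R"
        using T unfolding R_def real_sqrt_mult[symmetric]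
        by (simp add: power2_eq_square field_simps)
      finally show ?thesis by (simp add: \<alpha>_def)
    qed
    have "R * R = real T * (1 + H)" using H0[of T] by (simp add: R_def H_def)
    then have "real T * ((1 + H) * \<gamma>) = real T * (R * \<alpha>)" using \<alpha>T by algebra
    then have "(1 + H) * \<gamma> = R * \<alpha>" using T by simp
    then have \<alpha>_inv: "(1 + H) / \<alpha> = R / \<gamma>"
      using \<alpha> gamma(1) by (simp add: field_simps)

    obtain xhat gbar ghat v where alg: "\<And>t i. t \<in> {1..T} \<Longrightarrow>
        xhat i t = (\<Sum>j\<in>in_neighbours (E t) i. (A t $ i $ j) *\<^sub>R x T j t) \<and>
        gbar i t =
          (if t = 1 then g i 1 (xhat i 1)
           else ghat i (t - 1) + g i t (xhat i t) - g i (t - 1) (xhat i (t - 1))) \<and>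
        ghat i t = (\<Sum>j\<in>in_neighbours (E t) i. (A t $ i $ j) *\<^sub>R gbar j t) \<and>
        is_arg_min (\<lambda>y. y \<bullet> ghat i t) (\<lambda>y. y \<in> X) (v i t) \<and>
        x T i (t + 1) = xhat i t + \<alpha> *\<^sub>R (v i t - xhat i t)"
      using run[OF T] unfolding dofw_co_run_def \<alpha>_def H_def by blast
    have start: "x T i 1 = x1 i" for i using run[OF T] by (simp add: dofw_co_run_def)
    interpret dofw_co_trajectory A E \<zeta> Q X f g xstar M L G' K \<delta> \<omega> \<alpha> T "x T" xhat gbar ghat v
    proof unfold_locales
      show "x T i 1 \<in> X" for i using start initial by simp
      show "xhat i t = mix (A t) (\<lambda>j. x T j t) i" if "1 \<le> t" "t \<le> T" for i t
        using alg[of t i] that by (simp add: sum_in_neighbours_eq_mix)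
      show "gbar i 1 = g i 1 (xhat i 1)" for i
        using alg[of 1 i] T by simp
      show "gbar i (Suc t) = ghat i t + (g i (Suc t) (xhat i (Suc t)) - g i t (xhat i t))"
        if "1 \<le> t" "t < T" for i t
        using alg[of "Suc t" i] that by simp
      show "ghat i t = mix (A t) (\<lambda>j. gbar j t) i" if "1 \<le> t" "t \<le> T" for i t
        using alg[of t i] that by (simp add: sum_in_neighbours_eq_mix)
      show "is_arg_min (\<lambda>y. y \<bullet> ghat i t) (\<lambda>y. y \<in> X) (v i t)" if "1 \<le> t" "t \<le> T" for i t
        using alg[of t i] that atLeastAtMost_iff by blast
      show "x T i (Suc t) = xhat i t + \<alpha> *\<^sub>R (v i t - xhat i t)" if "1 \<le> t" "t \<le> T" for i t
        using alg[of t i] that by simp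
    qed (use X loss_convex loss_gradient minimiser diameter loss_lipschitz G' grad_lipschitz'
        K \<delta> \<omega> \<alpha> T in auto)

    define S where "S = (\<Sum>t=1..T. x_spread t)"
    define S' where "S' = (\<Sum>t=1..T. gbar_spread t)"
    have S: "S \<le> a * R"
    proof -
      have "S \<le> W * (M + 4 * (\<alpha> * M * real T))"
        using sum_x_spread_le by (simp add: S_def W_def)
      also have "\<dots> = W * M * (1 + 4 * \<gamma> * R)"
        using \<alpha>T by (simp add: algebra_simps)
      also have "\<dots> \<le> W * M * (R + 4 * \<gamma> * R)"
        using R1 W M by (intro mult_left_mono) auto
      finally show ?thesis by (simp add: a_def algebra_simps)
    qed
    have S': "S' \<le> b * (R + D)"
    proof -
      have "S' \<le> W * (2 * K + 4 * (D + G' * (S + \<alpha> * M * real T)))"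
        using sum_gbar_spread_le by (simp add: S_def S'_def W_def D_def D_eq)
      also have "\<dots> = W * (2 * K + 4 * D + 4 * G' * (S + \<gamma> * M * R))"
        using \<alpha>T by (simp add: algebra_simps)
      also have "\<dots> \<le> W * (2 * K * (R + D) + 4 * (R + D) + 4 * G' * ((a + \<gamma> * M) * (R + D)))"
      proof (intro mult_left_mono add_mono W)
        have "2 * K * 1 \<le> 2 * K * (R + D)"
          using K0 R1 D0[of T] by (intro mult_left_mono) (auto simp: D_def)
        then show "2 * K \<le> 2 * K * (R + D)" by simp
        show "D \<le> R + D" using R1 by simp
        have "S + \<gamma> * M * R \<le> (a + \<gamma> * M) * R" using S by (simp add: algebra_simps)
        also have "\<dots> \<le> (a + \<gamma> * M) * (R + D)"
          using nonneg M gamma D0[of T] by (intro mult_left_mono) (auto simp: D_def)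
        finally show "S + \<gamma> * M * R \<le> (a + \<gamma> * M) * (R + D)" .
      qed (use G' in auto)
      finally show ?thesis by (simp add: b_def algebra_simps)
    qed
    have "0 \<le> L * M * H" using H0[of T] L_nonneg M by (simp add: H_def)
    then have "L * M + 2 * H \<le> (L * M + 2) * (1 + H)" by (simp add: algebra_simps)
    then have "(L * M + 2 * H) / \<alpha> \<le> (L * M + 2) * ((1 + H) / \<alpha>)"
      using \<alpha> by (simp add: divide_right_mono)
    then have first: "(L * M + 2 * H) / \<alpha> \<le> (L * M + 2) / \<gamma> * R" by (simp add: \<alpha>_inv)
    have "dynamic_regret f xstar (x T) j T \<le> real CARD('n) *
        ((L + M * G') * S + M * S' + (L * M + 2 * H) / \<alpha> + G' * M\<^sup>2 * (\<alpha> * real T))"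
      using regret_le_spreads by (simp add: S_def S'_def H_def H_eq)
    also have "\<dots> \<le> real CARD('n) * ((L + M * G') * (a * (R + D)) + M * (b * (R + D))
        + (L * M + 2) / \<gamma> * (R + D) + G' * M\<^sup>2 * \<gamma> * (R + D))"
    proof (intro mult_left_mono add_mono M nonneg S')
      have RD: "R \<le> R + D" using D0[of T] by (simp add: D_def)
      show "S \<le> a * (R + D)" using S mult_left_mono[OF RD nonneg(1)] by linarith
      show "(L * M + 2 * H) / \<alpha> \<le> (L * M + 2) / \<gamma> * (R + D)"
        using first mult_left_mono[OF RD nonneg(4)] by linarith
      show "G' * M\<^sup>2 * (\<alpha> * real T) \<le> G' * M\<^sup>2 * \<gamma> * (R + D)"
        using mult_left_mono[OF RD nonneg(5)] by (simp add: \<alpha>T mult.assoc)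
    qed simp
    also have "\<dots> = C * (R + D)" by (simp add: C_def algebra_simps)
    finally show ?thesis by (simp add: R_def D_def H_def)
  qed
  then show ?thesis by blast
qed

end
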